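(* There exists a sequence $\mathcal M=(M_n)_{n\in\mathbb N}$, where each $M_n$ is an $n\times n$ Boolean matrix, such that: (1) $\mathcal M$ is stable, i.e. there exists $k\in\mathbb N$ such that the $k\times k$ Greater-Than matrix $\mathrm{GT}_k$ is not in $\mathrm{cl}(\mathcal M)$; (2) $\mathrm{R}(M_n)=\Theta(\log n)$; (3) $|\mathrm{cl}(\mathcal M)_n|\le 2^{O(n\log n)}$.
   Context: A Boolean matrix has entries in $\{0,1\}$. For an $n\times n$ Boolean matrix $M=[m_{ij}]$, in the two-party communication model Alice receives a row index $i$, Bob a column index $j$, and they must compute $m_{ij}$. A deterministic protocol is a binary tree whose internal nodes are owned by Alice or Bob and labelled by a Boolean function of that player's input, with leaves labelled $0$ or $1$; its cost is the depth of the tree. A (public-coin) randomized protocol of cost $c$ is a probability distribution over deterministic protocols of cost $c$; it computes $M$ with error at most $\epsilon$ if for every $(i,j)$ the probability that the sampled protocol outputs something other than $m_{ij}$ is at most $\epsilon$. $\mathrm{R}(M)$ denotes the smallest cost of a randomized protocol computing $M$ with error at most $1/3$. A submatrix is obtained by selecting any subset of rows and any subset of columns. For a sequence $\mathcal M$, $\mathrm{cl}(\mathcal M)$ is the set of all square matrices that are submatrices of some $M_n$, and $\mathrm{cl}(\mathcal M)_n$ is the set of $n\times n$ matrices in $\mathrm{cl}(\mathcal M)$. $\mathrm{GT}_k$ is the $k\times k$ matrix with $\mathrm{GT}_k(i,j)=1$ iff $i\le j$. Logarithms are base 2. *)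

theory Defs
  imports
    "Jordan_Normal_Form.DL_Submatrix"
    "HOL-Probability.Probability_Mass_Function"
    "HOL-Library.Landau_Symbols"
begin

text \<open>Deterministic two-party protocols. In \<open>Alice f l r\<close> and \<open>Bob g l r\<close> the left
  subtree is entered when the label evaluates to \<open>False\<close>, the right one otherwise. Rows and
  columns of a matrix are numbered from 0, as in \<open>Matrix.mat\<close>; the values of a label outside the
  index range of the matrix at hand are irrelevant.\<close>

datatype protocol =
    Leaf bool
  | Alice "nat \<Rightarrow> bool" protocol protocol
  | Bob "nat \<Rightarrow> bool" protocol protocol

fun depth :: "protocol \<Rightarrow> nat" where
  "depth (Leaf b) = 0"
| "depth (Alice f l r) = Suc (max (depth l) (depth r))"
| "depth (Bob g l r) = Suc (max (depth l) (depth r))"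

fun outcome :: "protocol \<Rightarrow> nat \<Rightarrow> nat \<Rightarrow> bool" where
  "outcome (Leaf b) i j = b"
| "outcome (Alice f l r) i j = (if f i then outcome r i j else outcome l i j)"
| "outcome (Bob g l r) i j = (if g j then outcome r i j else outcome l i j)"

text \<open>Discrete distributions are no restriction: on a fixed finite index range only finitely
  many protocols of a given depth are distinguishable.\<close>

definition has_cost :: "protocol pmf \<Rightarrow> nat \<Rightarrow> bool" where
  "has_cost P c \<longleftrightarrow> (\<forall>t \<in> set_pmf P. depth t = c)"

definition computes_with_error :: "protocol pmf \<Rightarrow> bool mat \<Rightarrow> real \<Rightarrow> bool" where
  "computes_with_error P A \<epsilon> \<longleftrightarrow>
     (\<forall>i < dim_row A. \<forall>j < dim_col A.
        measure_pmf.prob P {t. outcome t i j \<noteq> A $$ (i, j)} \<le> \<epsilon>)"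

definition rand_cc :: "bool mat \<Rightarrow> nat" where
  "rand_cc A = (LEAST c. \<exists>P. has_cost P c \<and> computes_with_error P A (1/3))"

definition cl :: "(nat \<Rightarrow> bool mat) \<Rightarrow> bool mat set" where
  "cl M = {A. square_mat A \<and> (\<exists>n I J. A = submatrix (M n) I J)}"

definition cl_n :: "(nat \<Rightarrow> bool mat) \<Rightarrow> nat \<Rightarrow> bool mat set" where
  "cl_n M n = cl M \<inter> carrier_mat n n"

definition GT :: "nat \<Rightarrow> bool mat" where
  "GT k = Matrix.mat k k (\<lambda>(i, j). i \<le> j)"

definition stable :: "(nat \<Rightarrow> bool mat) \<Rightarrow> bool" where
  "stable M \<longleftrightarrow> (\<exists>k. GT k \<notin> cl M)"

end

theory Submission
  imports Defs "HOL-Library.Discrete_Functions"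
begin

text \<open>Take a random sparse matrix: every one of the \<open>N\<close> rows draws \<open>d\<close> columns independently,
  where \<open>d\<close> is about \<open>N powr (1/8)\<close>, and has its ones there. A union bound shows that every
  \<open>k \<times> k\<close> submatrix with \<open>k \<le> d\<close> has fewer than \<open>4 * k\<close> ones; this excludes \<open>GT 8\<close>, and the
  \<open>n \<times> n\<close> submatrices either come from a matrix of size polynomial in \<open>n\<close> or have fewer than
  \<open>4 * n\<close> ones, so there are only \<open>n ^ O(n)\<close> of them. On the other hand, a deterministic protocol of
  depth \<open>c\<close> accepts one of at most \<open>2 ^ ((N + 2) * 2 ^ c)\<close> sets of entries. For each of these the
  fraction of the \<open>N * d\<close> draws that hit it exceeds its density by \<open>1/4\<close> with probability at most
  \<open>exp (- N * d / 64)\<close>. If \<open>d \<ge> 256 * 2 ^ c\<close>, a union bound over all protocols shows that some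
  matrix is not computed with error \<open>1/3\<close> at cost \<open>c\<close>.\<close>

section \<open>Sparsity of small submatrices\<close>

definition draws :: "nat \<Rightarrow> nat \<Rightarrow> (nat \<times> nat \<Rightarrow> nat) set" where
  "draws N d = {..<N} \<times> {..<d} \<rightarrow>\<^sub>E {..<N}"

definition hit_matrix :: "nat \<Rightarrow> nat \<Rightarrow> (nat \<times> nat \<Rightarrow> nat) \<Rightarrow> bool mat" where
  "hit_matrix N d f = Matrix.mat N N (\<lambda>(i, j). \<exists>s<d. f (i, s) = j)"

text \<open>\<open>P\<close> is a set of draws, not of matrix entries: that all draws in
  \<open>P\<close> land in \<open>T\<close> is then a product event, which can be counted
  exactly.\<close>

definition crowded :: "nat \<Rightarrow> nat \<Rightarrow> nat \<Rightarrow> (nat \<times> nat \<Rightarrow> nat) \<Rightarrow> bool" where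
  "crowded N d k f \<longleftrightarrow> (\<exists>S T P. S \<subseteq> {..<N} \<and> T \<subseteq> {..<N} \<and> card S = k \<and> card T = k \<and>
     P \<subseteq> S \<times> {..<d} \<and> card P = 4 * k \<and> f ` P \<subseteq> T)"

text \<open>An entry drawn repeatedly counts repeatedly, so the cardinality is a sum of
  \<open>N * d\<close> independent indicators.\<close>

definition hits :: "nat \<Rightarrow> nat \<Rightarrow> (nat \<times> nat) set \<Rightarrow> (nat \<times> nat \<Rightarrow> nat) \<Rightarrow> (nat \<times> nat) set" where
  "hits N d Q f = {(i, s). i < N \<and> s < d \<and> (i, f (i, s)) \<in> Q}"

lemma finite_draws [simp]: "finite (draws N d)"
  by (simp add: draws_def finite_PiE)

lemma card_draws: "card (draws N d) = N ^ (N * d)"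
  by (simp add: draws_def card_PiE)

lemma card_PiE_image_subset:
  assumes "finite A" "P \<subseteq> A" "T \<subseteq> B"
  shows "card {f \<in> A \<rightarrow>\<^sub>E B. f ` P \<subseteq> T} = card T ^ card P * card B ^ (card A - card P)"
proof -
  have "{f \<in> A \<rightarrow>\<^sub>E B. f ` P \<subseteq> T} = (\<Pi>\<^sub>E a\<in>A. if a \<in> P then T else B)"
    using assms by (fastforce simp: PiE_def Pi_def extensional_def split: if_splits)
  also have "card \<dots> = (\<Prod>a\<in>A. card (if a \<in> P then T else B))"
    using assms by (simp add: card_PiE)
  also have "\<dots> = (\<Prod>a\<in>A. if a \<in> P then card T else card B)"
    by (rule prod.cong) auto
  also have "\<dots> = card T ^ card P * card B ^ card (A - P)"
    using assms by (simp add: prod.If_cases Int_absorb1 Diff_eq)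
  also have "card (A - P) = card A - card P"
    using assms by (meson card_Diff_subset finite_subset)
  finally show ?thesis .
qed

lemma card_subsets_le:
  assumes "finite A"
  shows "card {S. S \<subseteq> A \<and> card S = k} \<le> card A ^ k"
proof (cases "k \<le> card A")
  case True
  then show ?thesis using assms by (simp add: n_subsets binomial_le_pow)
next
  case False
  then have "card A choose k = 0" by simp
  then show ?thesis by (simp only: n_subsets[OF assms])
qed

text \<open>Union bound. Fixed \<open>S\<close>, \<open>T\<close>, \<open>P\<close> succeed with
  probability \<open>(k / N) ^ (4 * k)\<close>; there are at most \<open>N ^ k\<close> choices each
  for \<open>S\<close> and \<open>T\<close> and \<open>(k * d) ^ (4 * k)\<close> for
  \<open>P\<close>. By \<open>k \<le> d\<close> and \<open>d ^ 8 \<le> N\<close> the product is at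
  most \<open>1 / d ^ (4 * k)\<close>.\<close>

lemma card_crowded:
  assumes "4 \<le> d" "d ^ 8 \<le> N" "1 \<le> k" "k \<le> d"
  shows "card {f \<in> draws N d. crowded N d k f} * d ^ (4 * k) \<le> N ^ (N * d)"
proof -
  define R where "R = {S. S \<subseteq> {..<N} \<and> card S = k}"
  define PP where "PP S = {P. P \<subseteq> S \<times> {..<d} \<and> card P = 4 * k}" for S :: "nat set"
  define E where "E T P = {f \<in> draws N d. f ` P \<subseteq> T}" for T P
  have NN: "N ^ (2 * k) = N ^ k * N ^ k" by (simp add: mult_2 power_add)
  have finR: "finite R" unfolding R_def by simp
  have "d \<le> d ^ 8" using assms by (simp add: self_le_power)
  then have dN: "d \<le> N" using assms by linarith
  \<comment> \<open>Makes the truncated subtraction \<open>N * d - 4 * k\<close> exact when the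
    powers of \<open>N\<close> are recombined at the end.\<close>
  have le: "4 * k \<le> N * d"
    using mult_mono[of 4 d k N] assms dN by (simp add: mult.commute)
  have finS: "finite S" if "S \<in> R" for S
    using that unfolding R_def by (auto intro: finite_subset)
  have finPP: "finite (PP S)" if "S \<in> R" for S
  proof -
    have "finite (Pow (S \<times> {..<d}))" using finS[OF that] by simp
    then show ?thesis unfolding PP_def by (rule finite_subset[rotated]) auto
  qed
  have cE: "card (E T P) = k ^ (4 * k) * N ^ (N * d - 4 * k)"
    if "S \<in> R" "T \<in> R" "P \<in> PP S" for S T P
  proof -
    have "P \<subseteq> {..<N} \<times> {..<d}" "T \<subseteq> {..<N}" "card P = 4 * k" "card T = k"
      using that unfolding R_def PP_def by auto
    then show ?thesis
      using card_PiE_image_subset[of "{..<N} \<times> {..<d}" P T "{..<N}"]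
      unfolding E_def draws_def by simp
  qed
  have cPP: "card (PP S) \<le> (k * d) ^ (4 * k)" if "S \<in> R" for S
    using card_subsets_le[of "S \<times> {..<d}" "4 * k"] finS[OF that] that
    unfolding PP_def R_def by simp
  have cR: "card R \<le> N ^ k"
    unfolding R_def using card_subsets_le[of "{..<N}" k] by simp
  define c where "c = k ^ (4 * k) * N ^ (N * d - 4 * k)"
  have "{f \<in> draws N d. crowded N d k f} \<subseteq> (\<Union>S\<in>R. \<Union>T\<in>R. \<Union>P\<in>PP S. E T P)"
    unfolding R_def PP_def E_def crowded_def by blast
  then have "card {f \<in> draws N d. crowded N d k f} \<le> card (\<Union>S\<in>R. \<Union>T\<in>R. \<Union>P\<in>PP S. E T P)"
    using finR finPP by (intro card_mono) (auto simp: E_def)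
  also have "\<dots> \<le> (\<Sum>S\<in>R. card (\<Union>T\<in>R. \<Union>P\<in>PP S. E T P))"
    using finR by (rule card_UN_le)
  also have "\<dots> \<le> (\<Sum>S\<in>R. \<Sum>T\<in>R. card (\<Union>P\<in>PP S. E T P))"
    using finR by (intro sum_mono card_UN_le)
  also have "\<dots> \<le> (\<Sum>S\<in>R. \<Sum>T\<in>R. \<Sum>P\<in>PP S. card (E T P))"
    using finPP by (intro sum_mono card_UN_le)
  also have "\<dots> = (\<Sum>S\<in>R. \<Sum>T\<in>R. \<Sum>P\<in>PP S. c)"
    using cE by (simp add: c_def)
  also have "\<dots> \<le> (\<Sum>S\<in>R. \<Sum>T\<in>R. (k * d) ^ (4 * k) * c)"
  proof (intro sum_mono)
    fix S T assume "S \<in> R" "T \<in> R"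
    then have "card (PP S) * c \<le> (k * d) ^ (4 * k) * c"
      by (intro mult_right_mono cPP) auto
    then show "(\<Sum>P\<in>PP S. c) \<le> (k * d) ^ (4 * k) * c" by simp
  qed
  also have "\<dots> = card R * card R * ((k * d) ^ (4 * k) * c)" by simp
  also have "\<dots> \<le> N ^ k * N ^ k * ((k * d) ^ (4 * k) * c)"
    by (intro mult_right_mono mult_mono cR) auto
  finally have "card {f \<in> draws N d. crowded N d k f} * d ^ (4 * k)
      \<le> N ^ k * N ^ k * ((k * d) ^ (4 * k) * c) * d ^ (4 * k)"
    by (rule mult_right_mono) simp
  also have "\<dots> = N ^ (2 * k) * (k * d * k * d) ^ (4 * k) * N ^ (N * d - 4 * k)"
    by (simp only: NN c_def power_mult_distrib) (simp only: mult_ac)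
  also have "\<dots> \<le> N ^ (2 * k) * N ^ (2 * k) * N ^ (N * d - 4 * k)"
  proof -
    have "k * d * k * d \<le> d * d * d * d" using assms by (intro mult_mono) auto
    then have "(k * d * k * d) ^ (4 * k) \<le> (d * d * d * d) ^ (4 * k)" by (rule power_mono) simp
    also have "\<dots> = (d ^ 4) ^ (4 * k)" by (simp only: power4_eq_xxxx)
    also have "\<dots> = (d ^ 8) ^ (2 * k)" by (simp flip: power_mult)
    also have "\<dots> \<le> N ^ (2 * k)" using assms by (intro power_mono) auto
    finally show ?thesis by (intro mult_right_mono mult_left_mono) auto
  qed
  also have "\<dots> = N ^ (N * d)" using le by (simp flip: power_add)
  finally show ?thesis .
qed

text \<open>Each \<open>k\<close> contributes a fraction of at most \<open>1 / d ^ 4\<close>, so the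
  \<open>d\<close> values together contribute at most \<open>1 / d ^ 3\<close>.\<close>

lemma card_crowded_union:
  assumes "4 \<le> d" "d ^ 8 \<le> N"
  shows "card {f \<in> draws N d. \<exists>k\<in>{1..d}. crowded N d k f} * 4 \<le> N ^ (N * d)"
proof -
  have *: "card {f \<in> draws N d. crowded N d k f} * d ^ 4 \<le> N ^ (N * d)" if "k \<in> {1..d}" for k
  proof -
    have "d ^ 4 \<le> d ^ (4 * k)" using that by (intro power_increasing) auto
    then have "card {f \<in> draws N d. crowded N d k f} * d ^ 4
        \<le> card {f \<in> draws N d. crowded N d k f} * d ^ (4 * k)" by simp
    also have "\<dots> \<le> N ^ (N * d)" using card_crowded assms that by simp
    finally show ?thesis .
  qed
  have "{f \<in> draws N d. \<exists>k\<in>{1..d}. crowded N d k f}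
      = (\<Union>k\<in>{1..d}. {f \<in> draws N d. crowded N d k f})" by blast
  then have "card {f \<in> draws N d. \<exists>k\<in>{1..d}. crowded N d k f}
      \<le> (\<Sum>k\<in>{1..d}. card {f \<in> draws N d. crowded N d k f})"
    using card_UN_le[of "{1..d}"] by simp
  then have "card {f \<in> draws N d. \<exists>k\<in>{1..d}. crowded N d k f} * d ^ 4
      \<le> (\<Sum>k\<in>{1..d}. card {f \<in> draws N d. crowded N d k f} * d ^ 4)"
    unfolding sum_distrib_right[symmetric] by (rule mult_right_mono) simp
  also have "\<dots> \<le> (\<Sum>k\<in>{1..d}. N ^ (N * d))" by (rule sum_mono) (use * in auto)
  also have "\<dots> = d * N ^ (N * d)" by simp
  finally have "d * (card {f \<in> draws N d. \<exists>k\<in>{1..d}. crowded N d k f} * d ^ 3) \<le> d * N ^ (N * d)"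
    by (simp add: power4_eq_xxxx power3_eq_cube mult_ac)
  then have "card {f \<in> draws N d. \<exists>k\<in>{1..d}. crowded N d k f} * d ^ 3 \<le> N ^ (N * d)"
    using assms by simp
  moreover have "4 \<le> d ^ 3" using assms self_le_power[of d 3] by linarith
  ultimately show ?thesis by (meson le_trans mult_le_mono2)
qed

section \<open>Concentration of the number of hits\<close>

text \<open>Chernoff's method: the exponential moment with parameter \<open>1/8\<close> factors over the draws, and
  \<open>exp x \<le> 1 + x + x\<^sup>2\<close> gives the exponent \<open>(1/8)\<^sup>2 - (1/8) * (1/4) = - 1/64\<close>.\<close>

lemma card_many_hits:
  assumes "0 < N" "Q \<subseteq> {..<N} \<times> {..<N}"
  shows "real (card {f \<in> draws N d.
            real N * real d * (real (card Q) / real N ^ 2 + 1 / 4) \<le> real (card (hits N d Q f))})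
          \<le> real N ^ (N * d) * exp (- (real N * real d / 64))"
proof -
  define lam :: real where "lam = 1 / 8"
  define a where "a = real (card Q) / real N ^ 2"
  define q where "q i = card {j \<in> {..<N}. (i, j) \<in> Q}" for i
  define A where "A = {..<N} \<times> {..<d}"
  define g where "g p b = exp (lam * of_bool ((fst p, b) \<in> Q))" for p :: "nat \<times> nat" and b :: nat
  define B where "B = {f \<in> draws N d. real N * real d * (a + 1 / 4) \<le> real (card (hits N d Q f))}"
  have el: "exp lam - 1 \<le> lam + lam ^ 2" using exp_bound[of lam] by (simp add: lam_def)
  have el0: "0 \<le> exp lam - 1" by (simp add: lam_def)
  have finA: "finite A" by (simp add: A_def)
  have finQ: "finite Q" using assms by (auto intro: finite_subset)
  have sumq: "(\<Sum>i<N. q i) = card Q"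
  proof -
    have "Q = (SIGMA i:{..<N}. {j \<in> {..<N}. (i, j) \<in> Q})" using assms by auto
    then have "card Q = card (SIGMA i:{..<N}. {j \<in> {..<N}. (i, j) \<in> Q})" by simp
    also have "\<dots> = (\<Sum>i<N. q i)" by (subst card_SigmaI) (auto simp: q_def)
    finally show ?thesis by simp
  qed
  have a01: "0 \<le> a" "a \<le> 1"
  proof -
    have "card Q \<le> card ({..<N} \<times> {..<N})" using assms by (intro card_mono) auto
    then have "card Q \<le> N ^ 2" by (simp add: power2_eq_square)
    then have "real (card Q) \<le> real N ^ 2" by (metis of_nat_le_iff of_nat_power)
    then show "a \<le> 1" "0 \<le> a" using assms by (auto simp: a_def divide_simps)
  qed
  have hitsum: "lam * real (card (hits N d Q f)) = (\<Sum>p\<in>A. lam * of_bool ((fst p, f p) \<in> Q))" for f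
  proof -
    have "hits N d Q f = {p \<in> A. (fst p, f p) \<in> Q}" by (auto simp: hits_def A_def)
    moreover have "(\<Sum>p\<in>A. of_bool ((fst p, f p) \<in> Q)) = real (card {p \<in> A. (fst p, f p) \<in> Q})"
      by (simp add: A_def sum.If_cases of_bool_def Int_def)
    ultimately show ?thesis by (simp flip: sum_distrib_left)
  qed
  have "(\<Sum>f\<in>draws N d. exp (lam * real (card (hits N d Q f)))) = (\<Sum>f\<in>draws N d. \<Prod>p\<in>A. g p (f p))"
    by (simp only: hitsum exp_sum[OF finA] g_def)
  \<comment> \<open>Independence of the draws: the sum over all functions of a product is the
    product of the sums.\<close>
  also have "\<dots> = (\<Prod>p\<in>A. \<Sum>b<N. g p b)"
    unfolding draws_def A_def by (rule prod_sum_PiE[symmetric]) auto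
  also have "\<dots> = (\<Prod>p\<in>A. real N + (exp lam - 1) * real (q (fst p)))"
  proof (rule prod.cong)
    fix p :: "nat \<times> nat"
    have "(\<Sum>b<N. g p b) = (\<Sum>b<N. 1 + (exp lam - 1) * of_bool ((fst p, b) \<in> Q))"
      by (rule sum.cong) (auto simp: g_def)
    also have "\<dots> = real N + (exp lam - 1) * (\<Sum>b<N. of_bool ((fst p, b) \<in> Q))"
      by (simp add: sum.distrib sum_distrib_left)
    also have "(\<Sum>b<N. of_bool ((fst p, b) \<in> Q)) = real (q (fst p))"
      by (simp add: q_def sum.If_cases of_bool_def Int_def)
    finally show "(\<Sum>b<N. g p b) = real N + (exp lam - 1) * real (q (fst p))" .
  qed simp
  \<comment> \<open>\<open>1 + x \<le> exp x\<close> moves the row counts \<open>q\<close> into an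
    exponent, where they add up to \<open>card Q\<close>; how \<open>Q\<close> is spread over the
    rows drops out.\<close>
  also have "\<dots> \<le> (\<Prod>p\<in>A. real N * exp ((exp lam - 1) * real (q (fst p)) / real N))"
  proof (rule prod_mono, intro conjI)
    fix p :: "nat \<times> nat"
    show "0 \<le> real N + (exp lam - 1) * real (q (fst p))" using el0 by simp
    have "real N * (1 + (exp lam - 1) * real (q (fst p)) / real N)
        \<le> real N * exp ((exp lam - 1) * real (q (fst p)) / real N)"
      by (intro mult_left_mono exp_ge_add_one_self) auto
    then show "real N + (exp lam - 1) * real (q (fst p))
        \<le> real N * exp ((exp lam - 1) * real (q (fst p)) / real N)"
      using assms by (simp add: distrib_left)
  qed
  also have "\<dots> = real N ^ (N * d) * exp (\<Sum>p\<in>A. (exp lam - 1) * real (q (fst p)) / real N)"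
    by (simp add: prod.distrib exp_sum A_def)
  also have "(\<Sum>p\<in>A. (exp lam - 1) * real (q (fst p)) / real N) = (exp lam - 1) * a * (real N * real d)"
  proof -
    have "(\<Sum>p\<in>A. (exp lam - 1) * real (q (fst p)) / real N)
        = (exp lam - 1) / real N * (\<Sum>p\<in>A. real (q (fst p)))"
      by (simp add: sum_distrib_left)
    also have "(\<Sum>p\<in>A. real (q (fst p))) = (\<Sum>i<N. \<Sum>s<d. real (q i))"
      unfolding A_def by (subst sum.cartesian_product) (simp add: case_prod_unfold)
    also have "\<dots> = real d * real (card Q)"
      by (simp flip: sumq add: sum_distrib_left)
    finally show ?thesis using assms by (simp add: a_def power2_eq_square)
  qed
  finally have upper: "(\<Sum>f\<in>draws N d. exp (lam * real (card (hits N d Q f))))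
      \<le> real N ^ (N * d) * exp ((exp lam - 1) * a * (real N * real d))" .
  \<comment> \<open>Markov's inequality for the exponential moment.\<close>
  have "real (card B) * exp (lam * (real N * real d * (a + 1 / 4)))
      = (\<Sum>f\<in>B. exp (lam * (real N * real d * (a + 1 / 4))))" by simp
  also have "\<dots> \<le> (\<Sum>f\<in>B. exp (lam * real (card (hits N d Q f))))"
    by (rule sum_mono) (auto simp: B_def lam_def)
  also have "\<dots> \<le> (\<Sum>f\<in>draws N d. exp (lam * real (card (hits N d Q f))))"
    by (rule sum_mono2) (auto simp: B_def)
  also note upper
  finally have "real (card B)
      \<le> real N ^ (N * d) * exp ((exp lam - 1) * a * (real N * real d))
          / exp (lam * (real N * real d * (a + 1 / 4)))"
    by (simp add: pos_le_divide_eq)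
  also have "\<dots> = real N ^ (N * d) * exp ((real N * real d) * ((exp lam - 1) * a - lam * (a + 1 / 4)))"
    by (simp add: exp_diff[symmetric] algebra_simps flip: times_divide_eq_right)
  also have "\<dots> \<le> real N ^ (N * d) * exp ((real N * real d) * (- (1 / 64)))"
  proof -
    \<comment> \<open>The terms \<open>lam * a\<close> cancel; what is left,
      \<open>lam ^ 2 * a - lam / 4\<close>, is largest at \<open>a = 1\<close>.\<close>
    have "(exp lam - 1) * a \<le> (lam + lam ^ 2) * a" using el a01 by (intro mult_right_mono) auto
    moreover have "lam ^ 2 * a \<le> lam ^ 2" using a01 by (simp add: mult_left_le)
    ultimately have "(exp lam - 1) * a - lam * (a + 1 / 4) \<le> lam ^ 2 - lam / 4"
      by (simp add: algebra_simps)
    also have "\<dots> = - (1 / 64)" by (simp add: lam_def power2_eq_square)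
    finally have "(real N * real d) * ((exp lam - 1) * a - lam * (a + 1 / 4)) \<le> (real N * real d) * (- (1 / 64))"
      by (intro mult_left_mono) auto
    then show ?thesis by (intro mult_left_mono) auto
  qed
  finally show ?thesis by (simp add: B_def a_def)
qed

section \<open>Protocols\<close>

definition accepted :: "nat \<Rightarrow> protocol \<Rightarrow> (nat \<times> nat) set" where
  "accepted N t = {(i, j). i < N \<and> j < N \<and> outcome t i j}"

text \<open>Depth at most \<open>c\<close> rather than exactly \<open>c\<close>: the two subtrees of
  a tree may differ in depth, and a lower bound must exclude all smaller costs too.\<close>

definition accepted_sets :: "nat \<Rightarrow> nat \<Rightarrow> (nat \<times> nat) set set" where
  "accepted_sets N c = accepted N ` {t. depth t \<le> c}"

lemma accepted_sets_0: "accepted_sets N 0 \<subseteq> {{}, {..<N} \<times> {..<N}}"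
proof -
  have "accepted N t \<in> {{}, {..<N} \<times> {..<N}}" if "depth t = 0" for t
    using that by (cases t; cases "\<exists>b. t = Leaf b") (auto simp: accepted_def)
  then show ?thesis unfolding accepted_sets_def by auto
qed

text \<open>Below \<open>N\<close> a label is just a subset \<open>X\<close> of
  \<open>{..<N}\<close>, so the accepted set is determined by the owner of the root,
  \<open>X\<close> and the accepted sets of the subtrees.\<close>

lemma accepted_sets_Suc:
  "accepted_sets N (Suc c) \<subseteq>
     (\<lambda>(X, L, R). {(i, j). if i \<in> X then (i, j) \<in> R else (i, j) \<in> L})
       ` (Pow {..<N} \<times> accepted_sets N c \<times> accepted_sets N c) \<union>
     (\<lambda>(X, L, R). {(i, j). if j \<in> X then (i, j) \<in> R else (i, j) \<in> L})
       ` (Pow {..<N} \<times> accepted_sets N c \<times> accepted_sets N c)"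
  (is "_ \<subseteq> ?A ` ?D \<union> ?B ` ?D")
proof
  fix Q assume "Q \<in> accepted_sets N (Suc c)"
  then obtain t where t: "depth t \<le> Suc c" and Q: "Q = accepted N t"
    unfolding accepted_sets_def by auto
  show "Q \<in> ?A ` ?D \<union> ?B ` ?D"
  proof (cases t)
    case (Leaf b)
    \<comment> \<open>A leaf is treated as a question with empty label and the same set on both
      sides.\<close>
    have "Q = ?A ({}, Q, Q)" by auto
    moreover have "Q \<in> accepted_sets N c" using Leaf Q unfolding accepted_sets_def by auto
    ultimately show ?thesis by (intro UnI1 image_eqI[of _ ?A "({}, Q, Q)"]) auto
  next
    case (Alice g l r)
    let ?X = "{i. i < N \<and> g i}"
    have "Q = ?A (?X, accepted N l, accepted N r)"
      using Alice Q by (auto simp: accepted_def)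
    moreover have "accepted N l \<in> accepted_sets N c" "accepted N r \<in> accepted_sets N c"
      using Alice t unfolding accepted_sets_def by auto
    ultimately show ?thesis
      by (intro UnI1 image_eqI[of _ ?A "(?X, accepted N l, accepted N r)"]) auto
  next
    case (Bob g l r)
    let ?X = "{j. j < N \<and> g j}"
    have "Q = ?B (?X, accepted N l, accepted N r)"
      using Bob Q by (auto simp: accepted_def)
    moreover have "accepted N l \<in> accepted_sets N c" "accepted N r \<in> accepted_sets N c"
      using Bob t unfolding accepted_sets_def by auto
    ultimately show ?thesis
      by (intro UnI2 image_eqI[of _ ?B "(?X, accepted N l, accepted N r)"]) auto
  qed
qed

text \<open>The factor \<open>2 ^ (N + 1)\<close> makes the recursion \<open>b' \<le> 2 * 2 ^ N * b\<^sup>2\<close> a plain squaring.\<close>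

lemma card_accepted_sets:
  "finite (accepted_sets N c) \<and> card (accepted_sets N c) * 2 ^ (N + 1) \<le> 2 ^ ((N + 2) * 2 ^ c)"
proof (induction c)
  case 0
  have "card (accepted_sets N 0) \<le> card {{}, {..<N} \<times> {..<N}}"
    by (rule card_mono[OF _ accepted_sets_0]) simp
  also have "\<dots> \<le> 2" by (simp add: card_insert_if)
  finally have "card (accepted_sets N 0) \<le> 2" .
  then show ?case using finite_subset[OF accepted_sets_0] by simp
next
  case (Suc c)
  let ?D = "Pow {..<N} \<times> accepted_sets N c \<times> accepted_sets N c"
  let ?b = "card (accepted_sets N c)"
  have fin: "finite ?D" using Suc by simp
  have D: "card ?D = 2 ^ N * (?b * ?b)" by (simp add: card_cartesian_product card_Pow)
  have "card (accepted_sets N (Suc c)) \<le> card ?D + card ?D"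
    using fin by (intro order.trans[OF card_mono[OF _ accepted_sets_Suc]]
        order.trans[OF card_Un_le] add_mono card_image_le) auto
  then have "card (accepted_sets N (Suc c)) * 2 ^ (N + 1) \<le> (card ?D + card ?D) * 2 ^ (N + 1)"
    by (rule mult_right_mono) simp
  also have "\<dots> = (?b * 2 ^ (N + 1)) * (?b * 2 ^ (N + 1))"
    unfolding D by simp
  also have "\<dots> \<le> 2 ^ ((N + 2) * 2 ^ c) * 2 ^ ((N + 2) * 2 ^ c)"
    using Suc by (intro mult_mono) auto
  also have "\<dots> = 2 ^ ((N + 2) * 2 ^ Suc c)"
    unfolding power_add[symmetric] by (simp add: algebra_simps)
  finally show ?case using finite_subset[OF accepted_sets_Suc] fin by blast
qed

section \<open>Logarithmic upper bound on the cost\<close>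

text \<open>Alice locates her row by binary search in \<open>c\<close> questions; Bob, who then
  knows the row, announces the entry. The offset \<open>a\<close> varies because the right half of
  an interval starts elsewhere.\<close>

lemma ex_protocol:
  "\<exists>t. depth t = Suc c \<and> (\<forall>i j. a \<le> i \<and> i < a + 2 ^ c \<longrightarrow> outcome t i j = h i j)"
proof (induction c arbitrary: a)
  case 0
  show ?case
    by (rule exI[of _ "Bob (h a) (Leaf False) (Leaf True)"])
      (auto simp: less_Suc_eq_le dest: le_antisym)
next
  case (Suc c)
  obtain l where l: "depth l = Suc c"
    "\<And>i j. a \<le> i \<Longrightarrow> i < a + 2 ^ c \<Longrightarrow> outcome l i j = h i j"
    using Suc.IH[of a] by blast
  obtain r where r: "depth r = Suc c"
    "\<And>i j. a + 2 ^ c \<le> i \<Longrightarrow> i < a + 2 ^ c + 2 ^ c \<Longrightarrow> outcome r i j = h i j"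
    using Suc.IH[of "a + 2 ^ c"] by blast
  show ?case
    by (rule exI[of _ "Alice (\<lambda>i. a + 2 ^ c \<le> i) l r"]) (use l r in auto)
qed

lemma ex_randomized_protocol:
  assumes "dim_row A \<le> 2 ^ c"
  shows "\<exists>P. has_cost P (Suc c) \<and> computes_with_error P A (1 / 3)"
proof -
  obtain t where "depth t = Suc c" "\<And>i j. i < 2 ^ c \<Longrightarrow> outcome t i j = A $$ (i, j)"
    using ex_protocol[of c 0 "\<lambda>i j. A $$ (i, j)"] by auto
  then have "has_cost (return_pmf t) (Suc c) \<and> computes_with_error (return_pmf t) A (1 / 3)"
    using assms unfolding has_cost_def computes_with_error_def by (auto simp: indicator_def)
  then show ?thesis by blast
qed

lemma rand_cc_le:
  assumes "dim_row A \<le> 2 ^ c"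
  shows "rand_cc A \<le> Suc c"
  unfolding rand_cc_def by (rule Least_le) (rule ex_randomized_protocol[OF assms])

text \<open>\<open>LEAST\<close> says something only once some cost is known to work;
  \<open>n < 2 ^ n\<close> supplies a crude one.\<close>

lemma rand_cc_attained: "\<exists>P. has_cost P (rand_cc A) \<and> computes_with_error P A (1 / 3)"
proof -
  have "dim_row A \<le> 2 ^ dim_row A" by (simp add: less_imp_le)
  from ex_randomized_protocol[OF this] show ?thesis unfolding rand_cc_def by (rule LeastI)
qed

section \<open>Lower bound on the cost by averaging over protocols\<close>

text \<open>Easy direction of Yao's principle: by linearity the expected weighted error is at most
  \<open>e\<close> times the total weight, so some protocol in the support does not exceed that. A
  free predicate \<open>bad\<close> allows errors to be counted on one side only.\<close>

lemma pmf_averaging: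
  fixes w :: "'b \<Rightarrow> real"
  assumes "finite I" "\<And>x. x \<in> I \<Longrightarrow> 0 \<le> w x"
    and "\<And>x. x \<in> I \<Longrightarrow> measure_pmf.prob P {t. bad x t} \<le> e"
  shows "\<exists>t\<in>set_pmf P. (\<Sum>x\<in>I. w x * of_bool (bad x t)) \<le> e * (\<Sum>x\<in>I. w x)"
proof (rule ccontr)
  assume "\<not> ?thesis"
  then have gt: "e * (\<Sum>x\<in>I. w x) < (\<Sum>x\<in>I. w x * of_bool (bad x t))" if "t \<in> set_pmf P" for t
    using that by force
  let ?X = "\<lambda>t. \<Sum>x\<in>I. w x * indicator {t. bad x t} t"
  have int: "integrable (measure_pmf P) (\<lambda>t. w x * indicator {t. bad x t} t)" for x
    by (intro integrable_mult_right)
      (auto simp: indicator_def intro: measure_pmf.integrable_const_bound[where B = 1])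
  have "e * (\<Sum>x\<in>I. w x) < measure_pmf.expectation P ?X"
  proof (rule measure_pmf.expectation_greater)
    show "integrable (measure_pmf P) ?X" by (intro Bochner_Integration.integrable_sum int)
    show "AE t in measure_pmf P. e * (\<Sum>x\<in>I. w x) < ?X t"
      using gt by (simp add: AE_measure_pmf_iff indicator_def of_bool_def)
  qed
  also have "measure_pmf.expectation P ?X = (\<Sum>x\<in>I. w x * measure_pmf.prob P {t. bad x t})"
    by (simp only: Bochner_Integration.integral_sum[OF int] integral_mult_right_zero) simp
  also have "\<dots> \<le> (\<Sum>x\<in>I. w x * e)" using assms by (intro sum_mono mult_left_mono) auto
  also have "\<dots> = e * (\<Sum>x\<in>I. w x)" by (simp add: sum_distrib_left mult.commute)
  finally show False by simp
qed

lemma card_ones_hit_matrix: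
  "card {(i, j). i < N \<and> j < N \<and> hit_matrix N d f $$ (i, j)} \<le> N * d"
proof -
  have "{(i, j). i < N \<and> j < N \<and> hit_matrix N d f $$ (i, j)}
      \<subseteq> (\<lambda>p. (fst p, f p)) ` ({..<N} \<times> {..<d})"
    by (force simp: hit_matrix_def)
  then have "card {(i, j). i < N \<and> j < N \<and> hit_matrix N d f $$ (i, j)} \<le> card ({..<N} \<times> {..<d})"
    by (meson card_image_le card_mono finite_SigmaI finite_imageI finite_lessThan order_trans)
  then show ?thesis by simp
qed

text \<open>The hard input distribution is, with probability one half each, the entry of a uniformly
  random draw and a uniformly random entry of the whole matrix.\<close>

lemma accurate_protocol_many_hits:
  assumes f: "f \<in> draws N d" and "0 < d" "12 * d \<le> N"
    and P: "computes_with_error P (hit_matrix N d f) (1 / 3)"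
  shows "\<exists>t\<in>set_pmf P. real N * real d * (real (card (accepted N t)) / real N ^ 2 + 1 / 4)
           \<le> real (card (hits N d (accepted N t) f))"
proof -
  let ?M = "hit_matrix N d f"
  let ?A = "{..<N} \<times> {..<d}" and ?B = "{..<N} \<times> {..<N}"
  \<comment> \<open>A drawn entry is a one, so the error there is rejection. At a uniform entry only
    false acceptance is counted, which bounds the error from below.\<close>
  define bad where "bad x t = (case x of Inl p \<Rightarrow> \<not> outcome t (fst p) (f p)
      | Inr p \<Rightarrow> outcome t (fst p) (snd p) \<and> \<not> ?M $$ p)" for x :: "(nat \<times> nat) + (nat \<times> nat)" and t
  \<comment> \<open>Each half has total weight 1, so the error bound becomes
    \<open>2 / 3\<close>.\<close>
  define w where "w x = (case x of Inl p \<Rightarrow> 1 / (real N * real d) | Inr p \<Rightarrow> 1 / real N ^ 2)"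
    for x :: "(nat \<times> nat) + (nat \<times> nat)"
  have N: "0 < N" using assms by linarith
  have P': "measure_pmf.prob P {t. outcome t i j \<noteq> ?M $$ (i, j)} \<le> 1 / 3" if "i < N" "j < N" for i j
    using P that unfolding computes_with_error_def hit_matrix_def by simp
  have range: "f (i, s) < N" if "i < N" "s < d" for i s
    using f that unfolding draws_def by (auto simp: PiE_def Pi_def)
  have "\<exists>t\<in>set_pmf P. (\<Sum>x\<in>?A <+> ?B. w x * of_bool (bad x t)) \<le> 1 / 3 * (\<Sum>x\<in>?A <+> ?B. w x)"
  proof (rule pmf_averaging)
    fix x assume "x \<in> ?A <+> ?B"
    then show "measure_pmf.prob P {t. bad x t} \<le> 1 / 3"
    proof
      fix p assume p: "x = Inl p" "p \<in> ?A"
      then have "?M $$ (fst p, f p)" using range by (auto simp: hit_matrix_def)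
      then have "{t. bad x t} = {t. outcome t (fst p) (f p) \<noteq> ?M $$ (fst p, f p)}"
        using p by (auto simp: bad_def)
      then show ?thesis using P'[of "fst p" "f p"] range p by auto
    next
      fix p assume p: "x = Inr p" "p \<in> ?B"
      then have "measure_pmf.prob P {t. bad x t}
          \<le> measure_pmf.prob P {t. outcome t (fst p) (snd p) \<noteq> ?M $$ (fst p, snd p)}"
        by (intro measure_pmf.finite_measure_mono) (auto simp: bad_def)
      also have "\<dots> \<le> 1 / 3" using P' p by auto
      finally show ?thesis .
    qed
  qed (auto simp: w_def split: sum.splits)
  then obtain t where t: "t \<in> set_pmf P"
    and le: "(\<Sum>x\<in>?A <+> ?B. w x * of_bool (bad x t)) \<le> 1 / 3 * (\<Sum>x\<in>?A <+> ?B. w x)" by blast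
  let ?Q = "accepted N t" and ?O = "{(i, j). i < N \<and> j < N \<and> ?M $$ (i, j)}"
  have W: "(\<Sum>x\<in>?A <+> ?B. w x) = 2"
    using N assms by (simp add: sum.Plus w_def power2_eq_square)
  have hits: "hits N d ?Q f \<subseteq> ?A" unfolding hits_def by auto
  have "(\<Sum>p\<in>?A. of_bool (\<not> outcome t (fst p) (f p))) = real (card (?A - hits N d ?Q f))"
  proof -
    have "?A - hits N d ?Q f = {p \<in> ?A. \<not> outcome t (fst p) (f p)}"
      using range by (auto simp: hits_def accepted_def)
    then show ?thesis by (simp add: sum.If_cases of_bool_def Int_def)
  qed
  also have "\<dots> = real (N * d) - real (card (hits N d ?Q f))"
    using hits card_mono[OF _ hits] by (simp add: card_Diff_subset finite_subset)
  finally have s1: "(\<Sum>p\<in>?A. of_bool (\<not> outcome t (fst p) (f p)))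
    = real (N * d) - real (card (hits N d ?Q f))" .
  have finQ: "finite ?Q" by (rule finite_subset[of _ ?B]) (auto simp: accepted_def)
  \<comment> \<open>The matrix has at most \<open>N * d\<close> ones, so all but that many accepted
    entries are false acceptances.\<close>
  have "real (card ?Q) - real (N * d) \<le> real (card ?Q) - real (card ?O)"
    using card_ones_hit_matrix[of N d f] by (simp flip: of_nat_mult)
  also have "\<dots> \<le> real (card (?Q - ?O))"
    using diff_card_le_card_Diff[of ?O ?Q] finite_subset[of ?O ?B] by force
  also have "\<dots> = (\<Sum>p\<in>?B. of_bool (outcome t (fst p) (snd p) \<and> \<not> ?M $$ p))"
  proof -
    have "?Q - ?O = {p \<in> ?B. outcome t (fst p) (snd p) \<and> \<not> ?M $$ p}"
      by (auto simp: accepted_def)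
    then show ?thesis by (simp add: sum.If_cases of_bool_def Int_def)
  qed
  finally have s2: "real (card ?Q) - real (N * d)
    \<le> (\<Sum>p\<in>?B. of_bool (outcome t (fst p) (snd p) \<and> \<not> ?M $$ p))" .
  define h where "h = real (card (hits N d ?Q f))"
  define q where "q = real (card ?Q)"
  have "(real (N * d) - h) / (real N * real d) + (q - real (N * d)) / real N ^ 2
      \<le> (\<Sum>x\<in>?A <+> ?B. w x * of_bool (bad x t))"
  proof -
    have "(\<Sum>x\<in>?A <+> ?B. w x * of_bool (bad x t))
        = (\<Sum>p\<in>?A. of_bool (\<not> outcome t (fst p) (f p))) / (real N * real d)
        + (\<Sum>p\<in>?B. of_bool (outcome t (fst p) (snd p) \<and> \<not> ?M $$ p)) / real N ^ 2"
      by (subst sum.Plus)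
        (simp_all only: w_def bad_def sum.case sum_divide_distrib comp_def times_divide_eq_left
          mult_1 finite_cartesian_product finite_lessThan)
    then show ?thesis using s2 by (simp only: s1 h_def q_def add_left_mono divide_right_mono zero_le_power2)
  qed
  also have "\<dots> \<le> 2 / 3" using le W by simp
  finally have "(real (N * d) - h) / (real N * real d) + (q - real (N * d)) / real N ^ 2 \<le> 2 / 3" .
  moreover have "(real (N * d) - h) / (real N * real d) = 1 - h / (real N * real d)"
    using N assms by (simp add: field_simps)
  moreover have "(q - real (N * d)) / real N ^ 2 = q / real N ^ 2 - real d / real N"
    using N by (simp add: field_simps power2_eq_square)
  \<comment> \<open>Source of the condition \<open>12 * d \<le> N\<close>:
    \<open>1 - 2 / 3 - 1 / 12 = 1 / 4\<close>.\<close>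
  moreover have "real d / real N \<le> 1 / 12"
    using assms N by (simp add: field_simps flip: of_nat_mult)
  ultimately have "q / real N ^ 2 + 1 / 4 \<le> h / (real N * real d)" by linarith
  then have "real N * real d * (q / real N ^ 2 + 1 / 4) \<le> h"
    using N assms by (simp add: pos_le_divide_eq mult.commute)
  then show ?thesis using t unfolding h_def q_def by blast
qed

lemma rand_cc_gt:
  assumes f: "f \<in> draws N d" and "0 < d" "12 * d \<le> N"
    and few: "\<forall>Q\<in>accepted_sets N c. real (card (hits N d Q f))
        < real N * real d * (real (card Q) / real N ^ 2 + 1 / 4)"
  shows "c < rand_cc (hit_matrix N d f)"
proof (rule ccontr)
  assume "\<not> ?thesis"
  then have le: "rand_cc (hit_matrix N d f) \<le> c" by simp
  obtain P where P: "has_cost P (rand_cc (hit_matrix N d f))"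
    "computes_with_error P (hit_matrix N d f) (1 / 3)" using rand_cc_attained by blast
  obtain t where t: "t \<in> set_pmf P" "real N * real d * (real (card (accepted N t)) / real N ^ 2 + 1 / 4)
           \<le> real (card (hits N d (accepted N t) f))"
    using accurate_protocol_many_hits[OF assms(1-3) P(2)] by blast
  have "accepted N t \<in> accepted_sets N c"
    using P(1) t(1) le unfolding accepted_sets_def has_cost_def by auto
  then show False using few t(2) by fastforce
qed

section \<open>A draw that is both sparse and hard\<close>

text \<open>Crowded draws are at most a quarter of all draws, and those with too many hits on some
  accepted set at most half. For the latter, the number of accepted sets is at most
  \<open>exp (N * d / 128)\<close>, which costs only half of the exponent \<open>N * d / 64\<close>
  gained by concentration.\<close>

lemma ex_good_draw:
  assumes d: "d = 256 * 2 ^ c" and N: "d ^ 8 \<le> N"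
  shows "\<exists>f\<in>draws N d. (\<forall>k\<in>{1..d}. \<not> crowded N d k f) \<and>
    (\<forall>Q\<in>accepted_sets N c. real (card (hits N d Q f))
        < real N * real d * (real (card Q) / real N ^ 2 + 1 / 4))"
proof -
  have d256: "256 \<le> d" using d by simp
  then have "d \<le> d ^ 8" by (simp add: self_le_power)
  then have dN: "d \<le> N" using N by linarith
  define n where "n = real N ^ (N * d)"
  have npos: "0 < n" using dN d256 by (simp add: n_def)
  define H where "H Q = {f \<in> draws N d.
      real N * real d * (real (card Q) / real N ^ 2 + 1 / 4) \<le> real (card (hits N d Q f))}" for Q
  define C where "C = {f \<in> draws N d. \<exists>k\<in>{1..d}. crowded N d k f}"
  have finB: "finite (accepted_sets N c)" using card_accepted_sets by blast
  have "card C * 4 \<le> N ^ (N * d)" unfolding C_def using card_crowded_union[of d N] d256 N by simp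
  then have "real (card C * 4) \<le> real (N ^ (N * d))" by (rule of_nat_mono)
  then have C: "real (card C) \<le> n / 4" by (simp add: n_def)
  have "card (accepted_sets N c) * 1 \<le> card (accepted_sets N c) * 2 ^ (N + 1)"
    by (intro mult_left_mono) auto
  also have "\<dots> \<le> 2 ^ ((N + 2) * 2 ^ c)" using card_accepted_sets by blast
  also have "\<dots> \<le> 2 ^ ((2 * N) * 2 ^ c)"
    using dN d256 by (intro power_increasing mult_right_mono) auto
  finally have "real (card (accepted_sets N c)) \<le> real (2 ^ ((2 * N) * 2 ^ c))"
    by (intro of_nat_mono) simp
  also have "\<dots> = 2 ^ ((2 * N) * 2 ^ c)" by simp
  also have "\<dots> \<le> exp 1 ^ ((2 * N) * 2 ^ c)"
    using exp_ge_add_one_self[of 1] by (intro power_mono) auto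
  \<comment> \<open>\<open>2 * N * 2 ^ c\<close> equals \<open>N * d / 128\<close>; the factor 256
    in \<open>d\<close> comes from here.\<close>
  also have "\<dots> = exp (real N * real d / 128)" by (simp add: d flip: exp_of_nat_mult)
  finally have B: "real (card (accepted_sets N c)) \<le> exp (real N * real d / 128)" .
  have H: "real (card (H Q)) \<le> n * exp (- (real N * real d / 64))" if "Q \<in> accepted_sets N c" for Q
  proof -
    have "Q \<subseteq> {..<N} \<times> {..<N}" using that by (auto simp: accepted_sets_def accepted_def)
    then show ?thesis using card_many_hits[of N Q d] dN d256 by (simp add: H_def n_def)
  qed
  have "real (card (\<Union>Q\<in>accepted_sets N c. H Q)) \<le> real (\<Sum>Q\<in>accepted_sets N c. card (H Q))"
    by (intro of_nat_mono card_UN_le finB)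
  also have "\<dots> = (\<Sum>Q\<in>accepted_sets N c. real (card (H Q)))" by simp
  also have "\<dots> \<le> (\<Sum>Q\<in>accepted_sets N c. n * exp (- (real N * real d / 64)))"
    by (rule sum_mono) (rule H)
  also have "\<dots> = real (card (accepted_sets N c)) * (n * exp (- (real N * real d / 64)))" by simp
  also have "\<dots> \<le> exp (real N * real d / 128) * (n * exp (- (real N * real d / 64)))"
    using npos by (intro mult_right_mono B) auto
  also have "\<dots> = n * exp (- (real N * real d / 128))"
    by (simp add: exp_minus field_simps flip: exp_add)
  also have "\<dots> \<le> n * exp (- 1)"
  proof -
    have "1 * 256 \<le> N * d" using dN d256 by (intro mult_mono) auto
    then have "256 \<le> real N * real d" by (simp flip: of_nat_mult)
    then show ?thesis using npos by (intro mult_left_mono) auto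
  qed
  also have "\<dots> \<le> n * (1 / 2)"
    using exp_ge_add_one_self[of 1] npos
    by (intro mult_left_mono) (auto simp: exp_minus field_simps)
  finally have U: "real (card (\<Union>Q\<in>accepted_sets N c. H Q)) \<le> n / 2" by simp
  have "real (card (C \<union> (\<Union>Q\<in>accepted_sets N c. H Q))) \<le> n / 4 + n / 2"
    using C U card_Un_le[of C "\<Union>Q\<in>accepted_sets N c. H Q"] by linarith
  also have "\<dots> < n" using npos by simp
  also have "n = real (card (draws N d))" by (simp add: card_draws n_def)
  finally have "card (C \<union> (\<Union>Q\<in>accepted_sets N c. H Q)) < card (draws N d)" by simp
  then have "\<not> draws N d \<subseteq> C \<union> (\<Union>Q\<in>accepted_sets N c. H Q)"
    by (metis (no_types, lifting) C_def H_def card_mono finB finite_Un finite_UN_I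
        finite_draws finite_subset leD mem_Collect_eq subsetI)
  then show ?thesis unfolding C_def H_def by (auto simp: not_le)
qed

section \<open>Submatrices\<close>

text \<open>The strict bound fails at \<open>k = 0\<close>, hence the restriction
  \<open>1 \<le> k\<close> in the construction below.\<close>

definition sparse :: "nat \<Rightarrow> bool mat \<Rightarrow> bool" where
  "sparse k A \<longleftrightarrow> (\<forall>I J. submatrix A I J \<in> carrier_mat k k \<longrightarrow>
     card {(i, j). i < k \<and> j < k \<and> submatrix A I J $$ (i, j)} < 4 * k)"

lemma inj_on_pick: "inj_on (pick I) {..<card {a. a < N \<and> a \<in> I}}"
proof (rule linorder_inj_onI)
  fix x y assume "x < y" "x \<in> {..<card {a. a < N \<and> a \<in> I}}" "y \<in> {..<card {a. a < N \<and> a \<in> I}}"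
  \<comment> \<open>An infinite \<open>I\<close> has \<open>card I = 0\<close>, hence the
    disjunction.\<close>
  moreover have "card {a. a < N \<and> a \<in> I} \<le> card I \<or> infinite I"
    by (metis (no_types, lifting) card_mono mem_Collect_eq subsetI)
  ultimately have "y < card I \<or> infinite I" by auto
  from pick_mono[OF this \<open>x < y\<close>] show "pick I x \<noteq> pick I y" by simp
qed auto

text \<open>Every one comes from some draw, so \<open>4 * k\<close> ones in a submatrix of size
  \<open>k\<close> yield \<open>4 * k\<close> draws from \<open>k\<close> rows landing in
  \<open>k\<close> columns.\<close>

lemma sparse_hit_matrix:
  assumes "\<not> crowded N d k f"
  shows "sparse k (hit_matrix N d f)"
  unfolding sparse_def
proof (intro allI impI, rule ccontr)
  fix I J
  let ?M = "hit_matrix N d f"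
  let ?O = "{(i, j). i < k \<and> j < k \<and> submatrix ?M I J $$ (i, j)}"
  assume carrier: "submatrix ?M I J \<in> carrier_mat k k" and "\<not> card ?O < 4 * k"
  then obtain O' where O': "O' \<subseteq> ?O" "card O' = 4 * k"
    by (meson not_less obtain_subset_with_card_n)
  have kI: "card {a. a < N \<and> a \<in> I} = k" and kJ: "card {a. a < N \<and> a \<in> J} = k"
    using carrier_matD[OF carrier] by (simp_all add: dim_submatrix hit_matrix_def)
  have inj: "inj_on (pick I) {..<k}" "inj_on (pick J) {..<k}"
    using inj_on_pick[of I N] inj_on_pick[of J N] unfolding kI kJ by simp_all
  have lt: "pick I i < N" "pick J i < N" if "i < k" for i
    using pick_le[of i N I] pick_le[of i N J] that unfolding kI kJ by simp_all
  define s where "s i j = (SOME s. s < d \<and> f (pick I i, s) = pick J j)" for i j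
  have s: "s i j < d \<and> f (pick I i, s i j) = pick J j" if "(i, j) \<in> ?O" for i j
  proof -
    have "submatrix ?M I J $$ (i, j) = ?M $$ (pick I i, pick J j)"
      using that kI kJ by (intro submatrix_index) (auto simp: hit_matrix_def)
    then have "\<exists>s. s < d \<and> f (pick I i, s) = pick J j"
      using that lt(1)[of i] lt(2)[of j] by (simp add: hit_matrix_def)
    then show ?thesis unfolding s_def by (rule someI_ex)
  qed
  define g where "g p = (pick I (fst p), s (fst p) (snd p))" for p
  have g: "f (g p) = pick J (snd p)" "snd (g p) < d" "fst p < k" "snd p < k" if "p \<in> O'" for p
    using s[of "fst p" "snd p"] O'(1) that by (auto simp: g_def)
  \<comment> \<open>Different entries get different draws: \<open>g p\<close> determines the row,
    and \<open>f (g p)\<close> the column.\<close>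
  have "inj_on g O'"
  proof (rule inj_onI)
    fix p q assume pq: "p \<in> O'" "q \<in> O'" "g p = g q"
    then have "pick J (snd p) = pick J (snd q)" using g(1) by metis
    then have "snd p = snd q" using inj(2) g(4) pq unfolding inj_on_def by auto
    moreover have "pick I (fst p) = pick I (fst q)" using pq(3) by (simp add: g_def)
    then have "fst p = fst q" using inj(1) g(3) pq unfolding inj_on_def by auto
    ultimately show "p = q" by (simp add: prod_eq_iff)
  qed
  then have "card (g ` O') = 4 * k" using O'(2) by (simp add: card_image)
  moreover have "card (pick I ` {..<k}) = k" "card (pick J ` {..<k}) = k"
    using inj by (simp_all add: card_image)
  moreover have "g ` O' \<subseteq> pick I ` {..<k} \<times> {..<d}" using g by (auto simp: g_def)
  moreover have "f ` g ` O' \<subseteq> pick J ` {..<k}" using g by auto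
  moreover have "pick I ` {..<k} \<subseteq> {..<N}" "pick J ` {..<k} \<subseteq> {..<N}" using lt by auto
  ultimately have "crowded N d k f" unfolding crowded_def by blast
  then show False using assms by contradiction
qed

section \<open>Choice of the matrix of each size\<close>

text \<open>The case \<open>k ^ 16 \<le> N\<close> serves the counting of submatrices,
  \<open>k = 8\<close> serves stability. The threshold \<open>2 ^ 64\<close> is \<open>d ^ 8\<close>
  for the least value \<open>d = 256\<close>, reached at \<open>c = 0\<close>.\<close>

lemma ex_sparse_hard_matrix:
  "\<exists>A \<in> carrier_mat N N. (\<forall>k\<ge>1. k ^ 16 \<le> N \<or> k = 8 \<longrightarrow> sparse k A) \<and>
     (2 ^ 64 \<le> N \<longrightarrow> log 2 (real N) < 8 * real (rand_cc A) + 64)"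
proof (cases "2 ^ 64 \<le> N")
  case False
  \<comment> \<open>No lower bound is claimed for small sizes, so the zero matrix serves.\<close>
  define A where "A = Matrix.mat N N (\<lambda>_. False)"
  have "sparse k A" if "1 \<le> k" for k
    unfolding sparse_def
  proof (intro allI impI)
    fix I J assume carrier: "submatrix A I J \<in> carrier_mat k k"
    have kI: "card {a. a < N \<and> a \<in> I} = k" and kJ: "card {a. a < N \<and> a \<in> J} = k"
      using carrier_matD[OF carrier] by (simp_all add: dim_submatrix A_def)
    have "\<not> submatrix A I J $$ (i, j)" if "i < k" "j < k" for i j
    proof -
      have "submatrix A I J $$ (i, j) = A $$ (pick I i, pick J j)"
        using that kI kJ by (intro submatrix_index) (simp_all add: A_def)
      moreover have "pick I i < N" "pick J j < N"
        using pick_le[of i N I] pick_le[of j N J] that unfolding kI kJ by simp_all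
      ultimately show ?thesis by (simp add: A_def)
    qed
    then have "{(i, j). i < k \<and> j < k \<and> submatrix A I J $$ (i, j)} = {}" by auto
    then show "card {(i, j). i < k \<and> j < k \<and> submatrix A I J $$ (i, j)} < 4 * k"
      using that by (simp only: card.empty)
  qed
  then show ?thesis using False by (intro bexI[of _ A]) (simp_all add: A_def)
next
  case True
  then have N0: "0 < N" by (rule less_le_trans[rotated]) simp
  define e where "e = floor_log N"
  have e: "2 ^ e \<le> N" "N < 2 ^ (e + 1)"
    using floor_log_exp2_le[OF N0] floor_log_exp2_gt[of N] by (auto simp: e_def)
  have "64 \<le> e"
  proof (rule ccontr)
    assume "\<not> 64 \<le> e"
    then have "(2 :: nat) ^ (e + 1) \<le> 2 ^ 64" by (intro power_increasing) auto
    then show False using e(2) True by linarith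
  qed
  \<comment> \<open>The largest \<open>c\<close> with
    \<open>d ^ 8 = 2 ^ (8 * c + 64) \<le> 2 ^ e\<close>, which keeps \<open>d ^ 8\<close> within a
    factor 256 of \<open>N\<close>.\<close>
  define c where "c = (e - 64) div 8"
  have c: "8 * c + 64 \<le> e" "e + 1 \<le> 8 * c + 72"
    using \<open>64 \<le> e\<close> unfolding c_def by linarith+
  define d :: nat where "d = 256 * 2 ^ c"
  have d8: "d ^ 8 = 2 ^ (8 * c + 64)"
    by (simp add: d_def power_mult_distrib power_add mult.commute flip: power_mult)
  also have "(2 :: nat) ^ (8 * c + 64) \<le> 2 ^ e" using c by (intro power_increasing) auto
  finally have dN: "d ^ 8 \<le> N" using e by linarith
  have "(2 :: nat) ^ (e + 1) \<le> 2 ^ (8 * c + 72)" using c by (intro power_increasing) auto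
  then have Nlt: "N < 2 ^ (8 * c + 72)" using e by linarith
  also have "\<dots> = 256 * d ^ 8" by (simp add: d8 power_add)
  finally have Nd: "N < 256 * d ^ 8" .
  have d256: "256 \<le> d" by (simp add: d_def)
  obtain f where f: "f \<in> draws N d" "\<forall>k\<in>{1..d}. \<not> crowded N d k f"
    "\<forall>Q\<in>accepted_sets N c. real (card (hits N d Q f))
        < real N * real d * (real (card Q) / real N ^ 2 + 1 / 4)"
    using ex_good_draw[OF d_def dN] by blast
  have "12 * d \<le> d * d" using d256 by (intro mult_right_mono) auto
  also have "\<dots> = d ^ 2" by (simp add: power2_eq_square)
  also have "\<dots> \<le> d ^ 8" using d256 by (intro power_increasing) auto
  finally have "12 * d \<le> N" using dN by linarith
  then have R: "c < rand_cc (hit_matrix N d f)" using rand_cc_gt[OF f(1) _ _ f(3)] d256 by simp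
  have "log 2 (real N) < real (8 * c + 72)"
  proof -
    have "real N < real (2 ^ (8 * c + 72))" using Nlt by (simp only: of_nat_less_iff)
    then have "real N < 2 ^ (8 * c + 72)" by (simp only: of_nat_power of_nat_numeral)
    then have "log 2 (real N) < log 2 (2 ^ (8 * c + 72))"
      using N0 by (subst log_less_cancel_iff) simp_all
    then show ?thesis by (simp only: log_pow_cancel)
  qed
  also have "\<dots> \<le> 8 * real (rand_cc (hit_matrix N d f)) + 64" using R by simp
  finally have lb: "log 2 (real N) < 8 * real (rand_cc (hit_matrix N d f)) + 64" .
  have "sparse k (hit_matrix N d f)" if "1 \<le> k" "k ^ 16 \<le> N \<or> k = 8" for k
  proof (rule sparse_hit_matrix)
    \<comment> \<open>Clear for \<open>k = 8\<close>. Otherwise \<open>k > d \<ge> 256\<close> would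
      give \<open>N < 256 * d ^ 8 \<le> k ^ 8 * k ^ 8 = k ^ 16\<close>.\<close>
    have "k \<le> d"
    proof (rule ccontr)
      assume "\<not> k \<le> d"
      then have "k \<noteq> 8" "256 \<le> k" "d \<le> k" using d256 by auto
      then have "256 * d ^ 8 \<le> k ^ 8 * k ^ 8"
        using self_le_power[of k 8] by (intro mult_mono power_mono) linarith+
      also have "\<dots> = k ^ 16" by (simp flip: power_add)
      finally show False using that \<open>k \<noteq> 8\<close> Nd by linarith
    qed
    then show "\<not> crowded N d k f" using f(2) that by auto
  qed
  then show ?thesis using lb by (intro bexI[of _ "hit_matrix N d f"]) (simp_all add: hit_matrix_def)
qed

section \<open>Stability and the number of submatrices\<close>

text \<open>\<open>36 = 8 * 9 / 2\<close> exceeds \<open>4 * 8\<close>, so \<open>GT 8\<close>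
  violates sparsity at size 8.\<close>

lemma card_ones_GT_8: "card {(i, j). i < 8 \<and> j < 8 \<and> GT 8 $$ (i, j)} = 36"
proof -
  \<comment> \<open>Counted by columns: the ones of column \<open>j\<close> are in the rows
    \<open>{..j}\<close>.\<close>
  have "{(i, j). i < 8 \<and> j < 8 \<and> GT 8 $$ (i, j)} = (SIGMA j:{..<8}. {..j})\<inverse>"
    by (auto simp: GT_def)
  then have "card {(i, j). i < 8 \<and> j < 8 \<and> GT 8 $$ (i, j)} = card (SIGMA j:{..<8::nat}. {..j})"
    by simp
  also have "\<dots> = 36" by (simp add: lessThan_nat_numeral)
  finally show ?thesis .
qed

lemma stable_if_sparse:
  assumes "\<And>n. sparse 8 (M n)"
  shows "stable M"
proof -
  have "GT 8 \<notin> cl M"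
  proof
    assume "GT 8 \<in> cl M"
    then obtain n I J where GT: "GT 8 = submatrix (M n) I J" unfolding cl_def by blast
    have "submatrix (M n) I J \<in> carrier_mat 8 8" unfolding GT[symmetric] by (simp add: GT_def)
    then have "card {(i, j). i < 8 \<and> j < 8 \<and> submatrix (M n) I J $$ (i, j)} < 4 * 8"
      using assms[of n] unfolding sparse_def by blast
    then show False unfolding GT[symmetric] card_ones_GT_8 by simp
  qed
  then show ?thesis unfolding stable_def by blast
qed

text \<open>If \<open>N < n ^ 16\<close>, a submatrix of \<open>M N\<close> is given by
  \<open>N\<close> and its lists of rows and columns: the first summand. If \<open>N\<close> is
  larger, the submatrix has fewer than \<open>4 * n\<close> ones and is given by a padded list of
  them, whatever \<open>N\<close> is: the second.\<close>

lemma card_cl_n_le: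
  assumes M: "\<And>N. M N \<in> carrier_mat N N"
    and sp: "\<And>N. n ^ 16 \<le> N \<Longrightarrow> sparse n (M N)"
  shows "card (cl_n M n) \<le> n ^ 16 * ((n ^ 16) ^ n * (n ^ 16) ^ n) + ((n + 1) * (n + 1)) ^ (4 * n)"
proof -
  define L where "L = {xs. set xs \<subseteq> {..<n ^ 16} \<and> length xs = n}"
  define K where "K = {xs. set xs \<subseteq> {..n} \<times> {..n} \<and> length xs = 4 * n}"
  define F where "F = (\<lambda>(N, xs, ys). Matrix.mat n n (\<lambda>(i, j). M N $$ (xs ! i, ys ! j)))"
  define G where "G xs = Matrix.mat n n (\<lambda>p. p \<in> set xs)" for xs
  have fin: "finite L" "finite K"
    unfolding L_def K_def by (intro finite_lists_length_eq; simp)+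
  have cL: "card L = (n ^ 16) ^ n"
    unfolding L_def by (subst card_lists_length_eq) auto
  have cK: "card K = ((n + 1) * (n + 1)) ^ (4 * n)"
    unfolding K_def by (subst card_lists_length_eq) (auto simp: card_cartesian_product)
  have "cl_n M n \<subseteq> F ` ({..<n ^ 16} \<times> L \<times> L) \<union> G ` K"
  proof
    fix A assume "A \<in> cl_n M n"
    then obtain N I J where A: "A \<in> carrier_mat n n" "A = submatrix (M N) I J"
      unfolding cl_n_def cl_def by auto
    show "A \<in> F ` ({..<n ^ 16} \<times> L \<times> L) \<union> G ` K"
    proof (cases "N < n ^ 16")
      case True
      let ?xs = "map (pick I) [0..<n]" and ?ys = "map (pick J) [0..<n]"
      have dims: "dim_row (M N) = N" "dim_col (M N) = N" using M[of N] by auto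
      have nI: "card {a. a < N \<and> a \<in> I} = n" and nJ: "card {a. a < N \<and> a \<in> J} = n"
        using carrier_matD[OF A(1)] unfolding A(2) by (simp_all add: dim_submatrix dims)
      have "pick I i < n ^ 16" "pick J i < n ^ 16" if "i < n" for i
        using pick_le[of i N I] pick_le[of i N J] that True unfolding nI nJ by simp_all
      then have "?xs \<in> L" "?ys \<in> L" by (auto simp: L_def)
      moreover have "A = F (N, ?xs, ?ys)"
        unfolding A(2) F_def submatrix_def dims nI nJ prod.case by (rule cong_mat) simp_all
      ultimately show ?thesis using True by blast
    next
      case False
      let ?O = "{(i, j). i < n \<and> j < n \<and> A $$ (i, j)}"
      have finO: "finite ?O" by (rule finite_subset[of _ "{..<n} \<times> {..<n}"]) auto
      have "card ?O < 4 * n"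
      proof -
        have "sparse n (M N)" using sp False by simp
        then show ?thesis using A(1) unfolding sparse_def A(2) by blast
      qed
      obtain xs where xs: "set xs = ?O" "distinct xs"
        using finite_distinct_list[OF finO] by blast
      then have len: "length xs < 4 * n" using \<open>card ?O < 4 * n\<close> distinct_card[of xs] by simp
      \<comment> \<open>the padding \<open>(n, n)\<close> lies outside the matrix\<close>
      define ys where "ys = xs @ replicate (4 * n - length xs) (n, n)"
      have "set xs \<subseteq> {..n} \<times> {..n}" unfolding xs(1) by auto
      then have "set ys \<subseteq> {..n} \<times> {..n}" unfolding ys_def by auto
      moreover have "length ys = 4 * n" using len by (simp add: ys_def)
      ultimately have "ys \<in> K" unfolding K_def by blast
      moreover have "A = G ys"
      proof (rule eq_matI)
        fix i j assume "i < dim_row (G ys)" "j < dim_col (G ys)"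
        then have ij: "i < n" "j < n" by (simp_all add: G_def)
        then have "(i, j) \<in> set ys \<longleftrightarrow> (i, j) \<in> set xs" by (auto simp: ys_def)
        then show "A $$ (i, j) = G ys $$ (i, j)" using ij by (simp add: G_def xs(1))
      qed (use A(1) in \<open>simp_all add: G_def\<close>)
      ultimately show ?thesis by blast
    qed
  qed
  then have "card (cl_n M n) \<le> card (F ` ({..<n ^ 16} \<times> L \<times> L) \<union> G ` K)"
    using fin by (intro card_mono) auto
  also have "\<dots> \<le> card ({..<n ^ 16} \<times> L \<times> L) + card K"
    using fin by (intro order.trans[OF card_Un_le] add_mono card_image_le) auto
  finally show ?thesis by (simp add: card_cartesian_product cL cK)
qed

text \<open>Both summands are at most \<open>n ^ (48 * n)\<close> and the factor 2 is absorbed by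
  \<open>n ^ n\<close>, which leaves \<open>n ^ (49 * n)\<close>.\<close>

lemma factorial_speed:
  assumes "\<And>n. 2 \<le> n \<Longrightarrow> card (cl_n M n)
      \<le> n ^ 16 * ((n ^ 16) ^ n * (n ^ 16) ^ n) + ((n + 1) * (n + 1)) ^ (4 * n)"
  shows "\<exists>g \<in> O(\<lambda>n. real n * log 2 (real n)). \<forall>n. real (card (cl_n M n)) \<le> 2 powr g n"
proof -
  \<comment> \<open>For \<open>n < 2\<close> the product \<open>n * log 2 n\<close> vanishes and its
    multiples may be too small as exponents; \<open>g\<close> takes the cardinality there, which
    does not affect its growth.\<close>
  define g where "g n = (if n < 2 then real (card (cl_n M n)) else 49 * (real n * log 2 (real n)))" for n
  have "g \<in> O(\<lambda>n. real n * log 2 (real n))"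
  proof (rule bigoI[of _ 49])
    show "\<forall>\<^sub>F n in sequentially. norm (g n) \<le> 49 * norm (real n * log 2 (real n))"
      using eventually_ge_at_top[of 2] by eventually_elim (simp add: g_def abs_mult)
  qed
  moreover have "real (card (cl_n M n)) \<le> 2 powr g n" for n
  proof (cases "n < 2")
    case True
    have "real (card (cl_n M n)) \<le> 2 powr real (card (cl_n M n))"
      by (metis less_exp less_imp_le of_nat_le_iff of_nat_numeral of_nat_power powr_realpow zero_less_numeral)
    then show ?thesis using True by (simp add: g_def)
  next
    case False
    then have n: "2 \<le> n" by simp
    have "(n + 1) * (n + 1) \<le> n ^ 2 * n ^ 2"
    proof -
      have "n + 1 \<le> 2 * n" using n by simp
      also have "\<dots> \<le> n ^ 2" using n by (simp add: power2_eq_square)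
      finally show ?thesis by (intro mult_mono) auto
    qed
    also have "\<dots> = n ^ 4" by (simp flip: power_add)
    finally have "((n + 1) * (n + 1)) ^ (4 * n) \<le> (n ^ 4) ^ (4 * n)" by (rule power_mono) simp
    also have "\<dots> = n ^ (16 * n)" by (simp flip: power_mult)
    also have "\<dots> \<le> n ^ (48 * n)" using n by (intro power_increasing) auto
    finally have 1: "((n + 1) * (n + 1)) ^ (4 * n) \<le> n ^ (48 * n)" .
    have "n ^ 16 * ((n ^ 16) ^ n * (n ^ 16) ^ n) = n ^ (16 + (16 * n + 16 * n))"
      by (simp only: power_add power_mult)
    also have "\<dots> \<le> n ^ (48 * n)" using n by (intro power_increasing) auto
    finally have 2: "n ^ 16 * ((n ^ 16) ^ n * (n ^ 16) ^ n) \<le> n ^ (48 * n)" .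
    have "card (cl_n M n) \<le> 2 * n ^ (48 * n)" using assms[OF n] 1 2 by linarith
    also have "\<dots> \<le> n ^ n * n ^ (48 * n)"
    proof (rule mult_right_mono)
      have "n \<le> n ^ n" using n by (intro self_le_power) auto
      then show "2 \<le> n ^ n" using n by linarith
    qed simp
    also have "\<dots> = n ^ (49 * n)" by (simp flip: power_add)
    finally have "real (card (cl_n M n)) \<le> real (n ^ (49 * n))" by (rule of_nat_mono)
    also have "\<dots> = real n powr real (49 * n)" using n by (simp only: powr_realpow of_nat_power)
    also have "\<dots> = (2 powr log 2 (real n)) powr real (49 * n)" using n by simp
    also have "\<dots> = 2 powr g n" using n by (simp only: powr_powr) (simp add: g_def mult_ac)
    finally show ?thesis .
  qed
  ultimately show ?thesis by blast
qed

theorem mainTheorem1: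
  shows "\<exists>M :: nat \<Rightarrow> bool mat.
    (\<forall>n. M n \<in> carrier_mat n n) \<and>
    stable M \<and>
    (\<lambda>n. real (rand_cc (M n))) \<in> \<Theta>(\<lambda>n. log 2 (real n)) \<and>
    (\<exists>g \<in> O(\<lambda>n. real n * log 2 (real n)). \<forall>n. real (card (cl_n M n)) \<le> 2 powr g n)"
proof -
  obtain M where M: "\<And>N. M N \<in> carrier_mat N N"
    and sp: "\<And>N k. 1 \<le> k \<Longrightarrow> k ^ 16 \<le> N \<or> k = 8 \<Longrightarrow> sparse k (M N)"
    and hard: "\<And>N. 2 ^ 64 \<le> N \<Longrightarrow> log 2 (real N) < 8 * real (rand_cc (M N)) + 64"
    using ex_sparse_hard_matrix by metis
  \<comment> \<open>The cost is at most \<open>floor_log n + 2\<close>, and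
    \<open>1 \<le> log 2 n\<close> gives the constant 3.\<close>
  have upper: "real (rand_cc (M n)) \<le> 3 * log 2 (real n)" if "2 \<le> n" for n
  proof -
    have "n \<le> 2 ^ (floor_log n + 1)" using floor_log_exp2_gt[of n] by simp
    then have "rand_cc (M n) \<le> Suc (floor_log n + 1)" using M[of n] by (intro rand_cc_le) auto
    then have "real (rand_cc (M n)) \<le> real (floor_log n) + 2" by simp
    moreover have "real (floor_log n) \<le> log 2 (real n)"
    proof -
      have "real (2 ^ floor_log n) \<le> real n"
        using floor_log_exp2_le[of n] that by (intro of_nat_mono) simp
      then have "2 powr real (floor_log n) \<le> real n" by (simp add: powr_realpow)
      then show ?thesis using that by (simp add: le_log_iff)
    qed
    moreover have "1 \<le> log 2 (real n)" using that by simp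
    ultimately show ?thesis by linarith
  qed
  have "(\<lambda>n. real (rand_cc (M n))) \<in> \<Theta>(\<lambda>n. log 2 (real n))"
  proof (rule bigthetaI)
    show "(\<lambda>n. real (rand_cc (M n))) \<in> O(\<lambda>n. log 2 (real n))"
      by (rule bigoI[of _ 3], rule eventually_mono[OF eventually_ge_at_top[of 2]])
        (use upper in force)
    have "(\<lambda>n. log 2 (real n)) \<in> O(\<lambda>n. real (rand_cc (M n)))"
    \<comment> \<open>From \<open>2 ^ 128\<close> on, the additive 64 is at most half of
      \<open>log 2 n\<close>, which doubles the factor 8.\<close>
    proof (rule bigoI[of _ 16], rule eventually_mono[OF eventually_ge_at_top[of "2 ^ 128"]])
      fix n :: nat assume n: "2 ^ 128 \<le> n"
      then have "2 ^ 64 \<le> n" by simp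
      moreover have "128 \<le> log 2 (real n)"
      proof -
        have "real (2 ^ 128) \<le> real n" using n by (rule of_nat_mono)
        then have "2 powr 128 \<le> real n" by simp
        then show ?thesis by (subst le_log_iff) auto
      qed
      ultimately show "norm (log 2 (real n)) \<le> 16 * norm (real (rand_cc (M n)))"
        using hard[of n] by simp
    qed
    then show "(\<lambda>n. real (rand_cc (M n))) \<in> \<Omega>(\<lambda>n. log 2 (real n))"
      by (simp add: bigomega_iff_bigo)
  qed
  moreover have "stable M" using sp by (intro stable_if_sparse) simp
  moreover have "\<exists>g \<in> O(\<lambda>n. real n * log 2 (real n)). \<forall>n. real (card (cl_n M n)) \<le> 2 powr g n"
    by (intro factorial_speed card_cl_n_le M sp) simp_all
  ultimately show ?thesis using M by blast
qed

end
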